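(* Let $G$ be an abelian group with no element of order two, let $A\subseteq G$ be finite and non-empty, and put $D=A-A$. Suppose that $$r_A(d)\ge \frac{|A|}{2}\qquad\text{for every } d\in D.$$ Then either $D$ is a finite subgroup of $G$, or there exist a finite subgroup $H\le G$ and elements $x,g\in G$ such that $$A=(x+H)\cup(x+g+H),$$ and the image of $g$ in $G/H$ has order different from $1$, $2$, and $3$ (infinite order is allowed). In the second case $$D=(-g+H)\cup H\cup(g+H).$$
   Context: For a finite non-empty subset $A$ of an abelian group $G$, $A-A=\{a-a':a,a'\in A\}$ and $r_A(d)=|\{(a,a')\in A^2: a-a'=d\}|$ for $d\in G$. *)

theory Defs
  imports "HOL-Algebra.Algebra"
begin

text \<open>
  Abelian groups are \<^locale>\<open>comm_group\<close> structures, hence written multiplicatively: the additive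
  $a - a'$ is \<open>a \<otimes> inv a'\<close>, and $x + g + H$ is the coset \<open>(x \<otimes> g) <# H\<close>.
\<close>

definition diff_set :: "('a, 'b) monoid_scheme \<Rightarrow> 'a set \<Rightarrow> 'a set"
  where "diff_set G A = {a \<otimes>\<^bsub>G\<^esub> inv\<^bsub>G\<^esub> a' | a a'. a \<in> A \<and> a' \<in> A}"

definition rep_count :: "('a, 'b) monoid_scheme \<Rightarrow> 'a set \<Rightarrow> 'a \<Rightarrow> nat"
  where "rep_count G A d = card {(a, a'). a \<in> A \<and> a' \<in> A \<and> a \<otimes>\<^bsub>G\<^esub> inv\<^bsub>G\<^esub> a' = d}"

text \<open>
  The coset \<open>H #> g\<close> is the image of \<open>g\<close> in \<open>G Mod H\<close>. The library assigns order \<open>0\<close> to elements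
  of infinite order, so infinite order is allowed below.
\<close>

definition two_coset_form ::
  "('a, 'b) monoid_scheme \<Rightarrow> 'a set \<Rightarrow> 'a set \<Rightarrow> 'a \<Rightarrow> 'a \<Rightarrow> bool"
  where "two_coset_form G A H x g \<longleftrightarrow>
    subgroup H G \<and> finite H \<and> x \<in> carrier G \<and> g \<in> carrier G \<and>
    A = (x <#\<^bsub>G\<^esub> H) \<union> ((x \<otimes>\<^bsub>G\<^esub> g) <#\<^bsub>G\<^esub> H) \<and>
    group.ord (G Mod H) (H #>\<^bsub>G\<^esub> g) \<notin> {1, 2, 3}"

end

theory Submission
  imports Defs
begin

text \<open>
  Write additively \<open>A\<^sub>d = A \<inter> (A + d)\<close>, so \<open>|A\<^sub>d| \<ge> |A|/2\<close> for \<open>d \<in> D\<close>. If \<open>A\<^sub>d\<close> and \<open>A\<^sub>e\<close> meet,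
  then \<open>d - e \<in> D\<close>; hence a conflict \<open>d - e \<notin> D\<close> forces \<open>A\<^sub>d\<close> and \<open>A\<^sub>e\<close> to be complementary halves
  of \<open>A\<close>. Without conflicts \<open>D\<close> is a subgroup. Let \<open>H\<close> be the stabiliser of \<open>D\<close>. It contains exactly
  the elements of \<open>D\<close> without conflict, and as soon as there is a conflict \<open>A\<close> is \<open>H\<close>-periodic.
  If, for some conflict \<open>(d, e)\<close>, every \<open>A\<^sub>f\<close> with \<open>f \<in> D - H\<close> is one of \<open>A\<^sub>d\<close>, \<open>A\<^sub>e\<close>, then
  \<open>b - A\<close> is the same for all \<open>b \<in> A\<^sub>d\<close>, so that \<open>A\<^sub>d\<close> and likewise \<open>A\<^sub>e\<close> are cosets of \<open>H\<close>. This
  holds whenever some \<open>e\<close> is in conflict with elements of two different cosets of \<open>H\<close>. Otherwise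
  conflict is a matching on \<open>D/H\<close>, and following the conflicts with a fixed difference
  \<open>z = d - e\<close> yields \<open>2z \<in> H\<close>; as there is no \<open>2\<close>-torsion, \<open>z \<in> H \<subseteq> D\<close>, a contradiction.
\<close>

section \<open>Cancellation, square roots and two-coset sets in abelian groups\<close>

context comm_group
begin

lemma inv_cancel:
  assumes "x \<in> carrier G" "y \<in> carrier G"
  shows "x \<otimes> (inv x \<otimes> y) = y" "inv x \<otimes> (x \<otimes> y) = y"
    "x \<otimes> (y \<otimes> inv x) = y" "inv x \<otimes> (y \<otimes> x) = y"
proof -
  show 1: "x \<otimes> (inv x \<otimes> y) = y" and 2: "inv x \<otimes> (x \<otimes> y) = y"
    using assms by (simp_all add: m_assoc[symmetric])
  show "x \<otimes> (y \<otimes> inv x) = y" using 1 assms by (simp add: m_comm[of y])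
  show "inv x \<otimes> (y \<otimes> x) = y" using 2 assms by (simp add: m_comm[of y])
qed

text \<open>AC-sorting may leave \<open>x\<close> and \<open>inv x\<close> separated by one factor;
  these rules still cancel the pair, so that \<open>cancel_simps\<close> can carry out the
  arithmetic below.\<close>

lemma inv_cancel_nested:
  assumes "x \<in> carrier G" "y \<in> carrier G" "w \<in> carrier G"
  shows "x \<otimes> (y \<otimes> (inv x \<otimes> w)) = y \<otimes> w" "inv x \<otimes> (y \<otimes> (x \<otimes> w)) = y \<otimes> w"
    "x \<otimes> (y \<otimes> (w \<otimes> inv x)) = y \<otimes> w" "inv x \<otimes> (y \<otimes> (w \<otimes> x)) = y \<otimes> w"
  using assms inv_cancel(3,4)[of x "y \<otimes> w"] m_lcomm[of x y "inv x \<otimes> w"]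
    m_lcomm[of "inv x" y "x \<otimes> w"]
  by (simp_all add: inv_cancel m_assoc)

lemmas cancel_simps = inv_mult m_ac inv_cancel inv_cancel_nested

text \<open>Without involutions squaring is injective on the whole group, so it permutes the finite
  set \<open>H\<close>. Hence \<open>z \<otimes> z\<close> has a square root inside
  \<open>H\<close>, which must be \<open>z\<close>.\<close>

lemma square_in_finite_subgroup:
  assumes "subgroup H G" "finite H"
    and no_invol: "\<And>y. y \<in> carrier G \<Longrightarrow> y \<otimes> y = \<one> \<Longrightarrow> y = \<one>"
    and z: "z \<in> carrier G" "z \<otimes> z \<in> H"
  shows "z \<in> H"
proof -
  have sub: "h \<in> carrier G" if "h \<in> H" for h
    using subgroup.mem_carrier[OF assms(1) that] .
  have root: "x = y" if "x \<in> carrier G" "y \<in> carrier G" "x \<otimes> x = y \<otimes> y" for x y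
  proof -
    have "(x \<otimes> inv y) \<otimes> (x \<otimes> inv y) = (x \<otimes> x) \<otimes> inv (y \<otimes> y)"
      using that(1,2) by (simp add: inv_mult m_ac)
    also have "\<dots> = \<one>" using that by simp
    finally have "x \<otimes> inv y = \<one>"
      by (rule no_invol[rotated]) (use that(1,2) in simp)
    then show ?thesis using that(1,2) inv_equality[of x "inv y"] by simp
  qed
  have "inj_on (\<lambda>h. h \<otimes> h) H" by (rule inj_onI) (rule root[OF sub sub])
  moreover have "(\<lambda>h. h \<otimes> h) ` H \<subseteq> H" using subgroup.m_closed[OF assms(1)] by blast
  ultimately have "(\<lambda>h. h \<otimes> h) ` H = H" using \<open>finite H\<close> by (simp add: endo_inj_surj)
  then obtain h where h: "h \<in> H" "z \<otimes> z = h \<otimes> h" using z(2) by blast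
  then have "z = h" using root[OF z(1) sub] by blast
  then show ?thesis using h by simp
qed

text \<open>Differences inside one coset fill \<open>H\<close>; differences across the two cosets
  fill those of \<open>g\<close> and \<open>inv g\<close>.\<close>

lemma diff_set_two_cosets:
  assumes H: "subgroup H G" and x: "x \<in> carrier G" and g: "g \<in> carrier G"
    and A: "A = (x <# H) \<union> ((x \<otimes> g) <# H)"
  shows "diff_set G A = (inv g <# H) \<union> H \<union> (g <# H)"
proof -
  interpret H: subgroup H G by (rule H)
  note [simp] = H.mem_carrier
  show ?thesis
  proof (intro equalityI subsetI)
    fix d assume "d \<in> diff_set G A"
    then obtain a b where ab: "a \<in> A" "b \<in> A" and d: "d = a \<otimes> inv b"
      by (auto simp: diff_set_def)
    have split: "\<exists>h\<in>H. c = x \<otimes> h \<or> c = x \<otimes> g \<otimes> h" if "c \<in> A" for c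
      using that by (auto simp: A l_coset_def)
    obtain h where h: "h \<in> H" "a = x \<otimes> h \<or> a = x \<otimes> g \<otimes> h" using split ab by blast
    obtain k where k: "k \<in> H" "b = x \<otimes> k \<or> b = x \<otimes> g \<otimes> k" using split ab by blast
    have hk: "h \<otimes> inv k \<in> H" using h k by simp
    have "d = h \<otimes> inv k \<or> d = g \<otimes> (h \<otimes> inv k) \<or> d = inv g \<otimes> (h \<otimes> inv k)"
      using h k x g by (auto simp: d cancel_simps)
    then show "d \<in> (inv g <# H) \<union> H \<union> (g <# H)"
      using hk by (auto simp: l_coset_def)
  next
    have mem: "x \<otimes> h \<in> A" "x \<otimes> g \<otimes> h \<in> A" if "h \<in> H" for h
      using that by (auto simp: A l_coset_def)
    have diff: "a \<otimes> inv b \<in> diff_set G A" if "a \<in> A" "b \<in> A" for a b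
      using that by (auto simp: diff_set_def)
    fix d assume "d \<in> (inv g <# H) \<union> H \<union> (g <# H)"
    then obtain h where h: "h \<in> H" and d: "d = inv g \<otimes> h \<or> d = h \<or> d = g \<otimes> h"
      by (auto simp: l_coset_def)
    have "(x \<otimes> h) \<otimes> inv (x \<otimes> g \<otimes> \<one>) = inv g \<otimes> h" "(x \<otimes> h) \<otimes> inv (x \<otimes> \<one>) = h"
      "(x \<otimes> g \<otimes> h) \<otimes> inv (x \<otimes> \<one>) = g \<otimes> h"
      using h x g by (simp_all add: cancel_simps)
    then show "d \<in> diff_set G A"
      using d diff mem h H.one_closed by metis
  qed
qed

end

section \<open>Overlaps of A with its translates\<close>

locale popular_differences = comm_group G for G (structure) +
  fixes A :: "'a set"
  assumes A_sub: "A \<subseteq> carrier G" and A_fin: "finite A" and A_ne: "A \<noteq> {}"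
    and popular: "d \<in> diff_set G A \<Longrightarrow> 2 * rep_count G A d \<ge> card A"
begin

abbreviation "D \<equiv> diff_set G A"

definition overlap :: "'a \<Rightarrow> 'a set" where
  "overlap d = {a \<in> A. a \<otimes> inv d \<in> A}"

text \<open>Mapping \<open>D\<close> into itself is enough to define a group, because
  \<open>D\<close> is closed under inversion; see \<open>inv_stab\<close>.\<close>

definition stab :: "'a set" where
  "stab = {h \<in> carrier G. \<forall>d\<in>D. h \<otimes> d \<in> D}"

definition conflict :: "'a \<Rightarrow> 'a \<Rightarrow> bool" where
  "conflict d e \<longleftrightarrow> d \<in> D \<and> e \<in> D \<and> d \<otimes> inv e \<notin> D"

lemma A_carrier [simp]: "a \<in> A \<Longrightarrow> a \<in> carrier G"
  using A_sub by blast

lemma diff_in_D: "a \<in> A \<Longrightarrow> b \<in> A \<Longrightarrow> a \<otimes> inv b \<in> D"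
  by (auto simp: diff_set_def)

lemma D_E:
  assumes "d \<in> D"
  obtains a b where "a \<in> A" "b \<in> A" "d = a \<otimes> inv b"
  using assms by (auto simp: diff_set_def)

lemma D_carrier [simp]: "d \<in> D \<Longrightarrow> d \<in> carrier G"
  by (auto simp: diff_set_def)

lemma finite_D: "finite D"
proof -
  have "D = (\<lambda>(a, b). a \<otimes> inv b) ` (A \<times> A)" by (auto simp: diff_set_def)
  then show ?thesis using A_fin by simp
qed

lemma one_D: "\<one> \<in> D"
proof -
  obtain a where "a \<in> A" using A_ne by blast
  then show ?thesis using diff_in_D[of a a] by simp
qed

lemma inv_D: "d \<in> D \<Longrightarrow> inv d \<in> D"
  by (auto elim!: D_E simp: inv_mult_group intro: diff_in_D)

lemma inv_D_iff: "d \<in> carrier G \<Longrightarrow> inv d \<in> D \<longleftrightarrow> d \<in> D"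
  using inv_D by force

lemma diff_D_comm:
  "x \<in> carrier G \<Longrightarrow> y \<in> carrier G \<Longrightarrow> x \<otimes> inv y \<in> D \<longleftrightarrow> y \<otimes> inv x \<in> D"
  using inv_D_iff[of "x \<otimes> inv y"] by (simp add: inv_mult_group)

lemma overlap_sub: "overlap d \<subseteq> A" and overlap_carrier [simp]: "a \<in> overlap d \<Longrightarrow> a \<in> carrier G"
  by (auto simp: overlap_def)

lemma finite_overlap [simp]: "finite (overlap d)"
  using A_fin overlap_sub finite_subset by blast

text \<open>A representation \<open>d = a \<otimes> inv b\<close> is determined by its first entry,
  as \<open>b = a \<otimes> inv d\<close>. Popularity thus becomes a lower bound on the size of the
  overlap.\<close>

lemma card_overlap:
  assumes "d \<in> carrier G" shows "card (overlap d) = rep_count G A d"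
proof -
  have "a \<otimes> inv b = d \<longleftrightarrow> b = a \<otimes> inv d" if "a \<in> A" "b \<in> A" for a b
    using that assms by (auto simp: cancel_simps)
  then have "{(a, b). a \<in> A \<and> b \<in> A \<and> a \<otimes> inv b = d}
      = {(a, b). a \<in> A \<and> b \<in> A \<and> b = a \<otimes> inv d}"
    by (intro Collect_cong) (simp only: split_beta cong: conj_cong)
  also have "\<dots> = (\<lambda>a. (a, a \<otimes> inv d)) ` overlap d"
    by (simp only: overlap_def) fast
  finally show ?thesis
    unfolding rep_count_def by (simp only:) (rule card_image[symmetric], rule inj_onI, simp)
qed

lemma half_overlap: "d \<in> D \<Longrightarrow> 2 * card (overlap d) \<ge> card A"
  using popular[of d] by (simp add: card_overlap)

lemma overlap_ne: "d \<in> D \<Longrightarrow> overlap d \<noteq> {}"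
  using half_overlap[of d] A_fin A_ne by auto

section \<open>Conflicts and complementary halves\<close>

lemma conflict_sym: "conflict d e \<Longrightarrow> conflict e d"
  by (auto simp: conflict_def diff_D_comm)

lemma conflict_inv: "conflict d e \<Longrightarrow> conflict (inv d) (inv e)"
  using inv_D diff_D_comm by (auto simp: conflict_def m_comm)

text \<open>A common point \<open>c\<close> would exhibit \<open>d \<otimes> inv e\<close> as the
  difference of the points \<open>c \<otimes> inv e\<close> and \<open>c \<otimes> inv d\<close> of
  \<open>A\<close>.\<close>

lemma conflict_disjoint:
  assumes "conflict d e" shows "overlap d \<inter> overlap e = {}"
proof (rule ccontr)
  assume "overlap d \<inter> overlap e \<noteq> {}"
  then obtain c where c: "c \<in> A" "c \<otimes> inv d \<in> A" "c \<otimes> inv e \<in> A"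
    by (auto simp: overlap_def)
  have "(c \<otimes> inv e) \<otimes> inv (c \<otimes> inv d) = d \<otimes> inv e"
    using assms c by (simp add: conflict_def cancel_simps)
  then show False using assms c diff_in_D by (metis conflict_def)
qed

text \<open>Two disjoint subsets of \<open>A\<close>, each with at least half of its elements, have
  exactly half each and exhaust it.\<close>

lemma conflict_halves:
  assumes "conflict d e"
  shows "overlap d \<union> overlap e = A" "2 * card (overlap d) = card A"
proof -
  have u: "card (overlap d \<union> overlap e) = card (overlap d) + card (overlap e)"
    using conflict_disjoint[OF assms] by (simp add: card_Un_disjoint)
  have le: "card (overlap d \<union> overlap e) \<le> card A"
    using A_fin overlap_sub by (simp add: card_mono)
  have "card A \<le> 2 * card (overlap d)" "card A \<le> 2 * card (overlap e)"
    using assms half_overlap by (auto simp: conflict_def)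
  then have card_eq: "card (overlap d \<union> overlap e) = card A" and "2 * card (overlap d) = card A"
    using u le by linarith+
  then show "2 * card (overlap d) = card A" by simp
  show "overlap d \<union> overlap e = A"
    by (rule card_subset_eq[OF A_fin _ card_eq]) (use overlap_sub in blast)
qed

text \<open>In particular all elements in conflict with the same \<open>e\<close> share one overlap,
  a fact used repeatedly below.\<close>

lemma conflict_complement: "conflict d e \<Longrightarrow> overlap d = A - overlap e"
  using conflict_disjoint[of d e] conflict_halves(1)[of d e] by blast

section \<open>The stabiliser of the difference set\<close>

lemma stab_carrier [simp]: "h \<in> stab \<Longrightarrow> h \<in> carrier G"
  by (simp add: stab_def)

lemma stab_D: "h \<in> stab \<Longrightarrow> d \<in> D \<Longrightarrow> h \<otimes> d \<in> D"
  unfolding stab_def by blast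

lemma stab_sub_D: "h \<in> stab \<Longrightarrow> h \<in> D"
  using stab_D[of h \<one>] one_D by simp

lemma inv_stab:
  assumes "h \<in> stab" shows "inv h \<in> stab"
proof -
  have "inv h \<otimes> d \<in> D" if "d \<in> D" for d
  proof -
    have "inv (h \<otimes> inv d) \<in> D" using inv_D[OF stab_D[OF assms inv_D[OF that]]] .
    then show ?thesis using assms that by (simp add: inv_mult)
  qed
  then show ?thesis unfolding stab_def using assms by simp
qed

lemma stab_subgroup: "subgroup stab G"
proof (rule subgroupI)
  show "stab \<subseteq> carrier G" by auto
  have "\<one> \<in> stab" unfolding stab_def by simp
  then show "stab \<noteq> {}" by blast
  show "inv h \<in> stab" if "h \<in> stab" for h by (rule inv_stab[OF that])
  show "h \<otimes> k \<in> stab" if "h \<in> stab" "k \<in> stab" for h k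
    using that unfolding stab_def by (simp add: m_assoc)
qed

lemma finite_stab: "finite stab"
  by (rule finite_subset[OF _ finite_D]) (use stab_sub_D in blast)

lemma translate_mem_D:
  assumes "h \<in> stab" "x \<in> carrier G" shows "h \<otimes> x \<in> D \<longleftrightarrow> x \<in> D"
proof
  assume "h \<otimes> x \<in> D"
  then have "inv h \<otimes> (h \<otimes> x) \<in> D" by (rule stab_D[OF inv_stab[OF assms(1)]])
  then show "x \<in> D" using assms by (simp add: cancel_simps)
qed (rule stab_D[OF assms(1)])

lemma conflict_translate:
  assumes "conflict d e" "h \<in> stab" shows "conflict (h \<otimes> d) e"
  using assms stab_D translate_mem_D[of h "d \<otimes> inv e"]
  by (auto simp: conflict_def m_assoc)

text \<open>If translation by \<open>f\<close> moves some \<open>d \<in> D\<close> out of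
  \<open>D\<close>, then \<open>f\<close> is in conflict with \<open>inv d\<close>.\<close>

lemma obtain_conflict:
  assumes "f \<in> D" "f \<notin> stab"
  obtains e where "conflict f e"
proof -
  obtain d where d: "d \<in> D" "f \<otimes> d \<notin> D" using assms unfolding stab_def by auto
  then have "conflict f (inv d)" using assms inv_D by (simp add: conflict_def)
  then show ?thesis using that by blast
qed

lemma card_overlap_outside_stab: "f \<in> D \<Longrightarrow> f \<notin> stab \<Longrightarrow> 2 * card (overlap f) = card A"
  by (metis obtain_conflict conflict_halves(2))

lemma subgroup_D:
  assumes "\<And>d e. \<not> conflict d e" shows "subgroup D G"
proof (rule subgroupI)
  show "D \<subseteq> carrier G" by auto
  show "D \<noteq> {}" using one_D by blast
  show "inv d \<in> D" if "d \<in> D" for d using inv_D that .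
  show "d \<otimes> e \<in> D" if "d \<in> D" "e \<in> D" for d e
    using assms[of d "inv e"] that inv_D by (simp add: conflict_def)
qed

text \<open>Both \<open>d\<close> and \<open>inv h \<otimes> d\<close> are in conflict with
  \<open>e\<close>, hence have the same overlap. For \<open>a \<in> overlap (inv d)\<close> it
  contains \<open>a \<otimes> d\<close>, which gives \<open>h \<otimes> a \<in> A\<close>. The
  overlaps of \<open>inv d\<close> and \<open>inv e\<close> cover \<open>A\<close>, since these are
  in conflict as well.\<close>

lemma A_periodic:
  assumes "conflict d e" "h \<in> stab" "a \<in> A"
  shows "h \<otimes> a \<in> A"
proof -
  have key: "h \<otimes> a \<in> A" if c: "conflict d e" and a: "a \<in> overlap (inv d)" for d e
  proof -
    have d [simp]: "d \<in> carrier G" using c by (simp add: conflict_def)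
    have aA: "a \<in> A" "a \<otimes> d \<in> A" using a by (auto simp: overlap_def)
    then have "a \<otimes> d \<in> overlap d" by (simp add: overlap_def cancel_simps)
    moreover have "overlap (inv h \<otimes> d) = overlap d"
      using conflict_complement[OF c] conflict_complement[OF conflict_translate]
        c assms(2) inv_stab by metis
    ultimately have "a \<otimes> d \<in> overlap (inv h \<otimes> d)" by simp
    then have "(a \<otimes> d) \<otimes> inv (inv h \<otimes> d) \<in> A" by (simp add: overlap_def)
    then show ?thesis using aA assms(2) by (simp add: cancel_simps)
  qed
  have "a \<in> overlap (inv d) \<or> a \<in> overlap (inv e)"
    using conflict_halves(1)[OF conflict_inv[OF assms(1)]] assms(3) by blast
  then show ?thesis using key assms(1) conflict_sym by blast
qed

section \<open>The two-coset structure when all overlaps are pure\<close>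

lemma stab_A_sub_stab:
  assumes "s \<in> carrier G" "\<And>a. a \<in> A \<Longrightarrow> s \<otimes> a \<in> A"
  shows "s \<in> stab"
proof -
  have "s \<otimes> d \<in> D" if d: "d \<in> D" for d
  proof -
    obtain a b where ab: "a \<in> A" "b \<in> A" "d = a \<otimes> inv b" by (rule D_E[OF d])
    then have "(s \<otimes> a) \<otimes> inv b \<in> D" using assms diff_in_D by blast
    then show ?thesis using ab assms(1) by (simp add: m_assoc)
  qed
  then show ?thesis unfolding stab_def using assms(1) by simp
qed

text \<open>For \<open>b\<close> and \<open>b'\<close> in \<open>overlap d\<close> and
  \<open>a \<in> A\<close>, the difference \<open>f = b \<otimes> inv a\<close> has \<open>b\<close>
  in its overlap, which therefore is not \<open>overlap e\<close>. Either \<open>f\<close> is in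
  \<open>stab\<close> or \<open>overlap f\<close> also contains \<open>b'\<close>; both give
  \<open>b' \<otimes> inv f \<in> A\<close>. So \<open>b' \<otimes> inv b\<close> is a period of
  \<open>A\<close>. The other inclusion is periodicity.\<close>

lemma overlap_coset:
  assumes c: "conflict d e"
    and pure: "\<And>f. f \<in> D \<Longrightarrow> f \<in> stab \<or> overlap f = overlap d \<or> overlap f = overlap e"
    and b: "b \<in> overlap d"
  shows "overlap d = b <# stab"
proof (intro equalityI subsetI)
  fix b' assume b': "b' \<in> overlap d"
  have bA: "b \<in> A" "b' \<in> A" using b b' by (auto simp: overlap_def)
  have "(b' \<otimes> inv b) \<otimes> a \<in> A" if a: "a \<in> A" for a
  proof -
    have f: "b \<otimes> inv a \<in> D" using a bA diff_in_D by blast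
    have "b \<in> overlap (b \<otimes> inv a)" using a bA by (simp add: overlap_def cancel_simps)
    then have "overlap (b \<otimes> inv a) \<noteq> overlap e" using conflict_disjoint[OF c] b by blast
    then consider "b \<otimes> inv a \<in> stab" | "b' \<in> overlap (b \<otimes> inv a)"
      using pure[OF f] b' by blast
    then have "b' \<otimes> inv (b \<otimes> inv a) \<in> A"
    proof cases
      case 1
      then have "inv (b \<otimes> inv a) \<otimes> b' \<in> A" using inv_stab A_periodic[OF c] bA by blast
      then show ?thesis using a bA by (simp add: m_comm)
    qed (simp add: overlap_def)
    then show ?thesis using a bA by (simp add: cancel_simps)
  qed
  then have "b' \<otimes> inv b \<in> stab" using stab_A_sub_stab bA by simp
  moreover have "b' = b \<otimes> (b' \<otimes> inv b)" using bA by (simp add: cancel_simps)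
  ultimately show "b' \<in> b <# stab" unfolding l_coset_def by blast
next
  fix y assume "y \<in> b <# stab"
  then obtain h where h: "h \<in> stab" "y = b \<otimes> h" by (auto simp: l_coset_def)
  have bA: "b \<in> A" "b \<otimes> inv d \<in> A" "d \<in> carrier G" using b c by (auto simp: overlap_def conflict_def)
  then have "h \<otimes> b \<in> A" "h \<otimes> (b \<otimes> inv d) \<in> A" using A_periodic[OF c] h by blast+
  then show "y \<in> overlap d" using h bA by (simp add: overlap_def m_ac)
qed

text \<open>The two overlaps are cosets of \<open>stab\<close> with union \<open>A\<close>, and
  \<open>g\<close> is the quotient of chosen representatives. The condition on its order rests on
  \<open>g \<otimes> g \<notin> D\<close>.\<close>

lemma two_coset_form_of_pure:
  assumes c: "conflict d e"
    and pure: "\<And>f. f \<in> D \<Longrightarrow> f \<in> stab \<or> overlap f = overlap d \<or> overlap f = overlap e"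
  shows "\<exists>H x g. two_coset_form G A H x g"
proof -
  obtain y x where y: "y \<in> overlap d" and x: "x \<in> overlap e"
    using overlap_ne c by (metis conflict_def equals0I)
  have [simp]: "x \<in> carrier G" "y \<in> carrier G" using x y by auto
  define g where "g = inv x \<otimes> y"
  have g [simp]: "g \<in> carrier G" and xg: "x \<otimes> g = y" by (simp_all add: g_def cancel_simps)
  have "overlap d = y <# stab" by (rule overlap_coset[OF c pure y])
  moreover have "overlap e = x <# stab"
    by (rule overlap_coset[OF conflict_sym[OF c] _ x]) (use pure in blast)
  ultimately have A: "A = (x <# stab) \<union> ((x \<otimes> g) <# stab)"
    using conflict_halves(1)[OF c] xg by auto
  have D: "D = (inv g <# stab) \<union> stab \<union> (g <# stab)"
    by (rule diff_set_two_cosets[OF stab_subgroup _ _ A]) auto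
  interpret H: subgroup stab G by (rule stab_subgroup)
  interpret N: normal stab G by (rule subgroup_imp_normal[OF stab_subgroup])
  interpret Q: group "G Mod stab" by (rule N.factorgroup_is_group)
  \<comment> \<open>Otherwise \<open>D\<close> would contain every quotient of two of
    \<open>\<one>\<close>, \<open>g\<close>, \<open>inv g\<close>. These represent all of
    \<open>D\<close> modulo \<open>stab\<close>, so no conflict could exist.\<close>
  have gg: "g \<otimes> g \<notin> D"
  proof
    assume gg: "g \<otimes> g \<in> D"
    have trans: "u \<otimes> h \<in> D" if "u \<in> D" "h \<in> stab" for u h
      using stab_D[OF that(2,1)] that by (simp add: m_comm)
    have gD: "g \<in> D" using x y xg diff_in_D overlap_sub
      by (metis g_def m_comm inv_closed \<open>x \<in> carrier G\<close> \<open>y \<in> carrier G\<close> subsetD)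
    have igg: "inv g \<otimes> inv g \<in> D" using inv_D[OF gg] by (simp add: inv_mult)
    have rep: "\<exists>t\<in>{\<one>, g, inv g}. \<exists>h\<in>stab. u = t \<otimes> h" if "u \<in> D" for u
    proof -
      have "u \<in> (inv g <# stab) \<union> stab \<union> (g <# stab)" using that D by simp
      moreover have "u = \<one> \<otimes> u" using that by simp
      ultimately show ?thesis unfolding l_coset_def by blast
    qed
    have dD: "d \<in> D" and eD: "e \<in> D" using c by (simp_all add: conflict_def)
    obtain t h where h: "h \<in> stab" "d = t \<otimes> h" "t = \<one> \<or> t = g \<or> t = inv g"
      using rep[OF dD] by blast
    obtain s k where k: "k \<in> stab" "e = s \<otimes> k" "s = \<one> \<or> s = g \<or> s = inv g"
      using rep[OF eD] by blast
    have [simp]: "t \<in> carrier G" "s \<in> carrier G" using h k by auto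
    have igD: "inv g \<in> D" by (rule inv_D[OF gD])
    have "t \<otimes> inv s \<in> D"
      using h(3) k(3) by (elim disjE) (simp_all add: gg igg gD igD one_D)
    then have "(t \<otimes> inv s) \<otimes> (h \<otimes> inv k) \<in> D"
      by (rule trans) (rule H.m_closed[OF h(1) inv_stab[OF k(1)]])
    moreover have "d \<otimes> inv e = (t \<otimes> inv s) \<otimes> (h \<otimes> inv k)"
      using stab_carrier[OF h(1)] stab_carrier[OF k(1)] by (simp add: h(2) k(2) inv_mult m_ac)
    ultimately show False using c by (simp add: conflict_def)
  qed
  have "Q.ord (stab #> g) \<notin> {1, 2, 3}"
  proof
    let ?n = "Q.ord (stab #> g)"
    assume n: "?n \<in> {1, 2, 3}"
    have "stab #> g \<in> carrier (G Mod stab)" using g by (auto simp: FactGroup_def RCOSETS_def)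
    then have "(stab #> g) [^]\<^bsub>G Mod stab\<^esub> ?n = stab" using Q.pow_ord_eq_1 by (simp add: FactGroup_def)
    then have "stab #> (g [^] ?n) = stab" using N.FactGroup_pow g by metis
    then have pow: "g [^] ?n \<in> stab" using coset_join1[OF _ _ stab_subgroup] g by blast
    \<comment> \<open>Each order would put \<open>g \<otimes> g\<close> into \<open>D\<close>:
      orders 1 and 2 into \<open>stab\<close>, order 3 into the coset of
      \<open>inv g\<close>.\<close>
    consider "?n = 1" | "?n = 2" | "?n = 3" using n by auto
    then show False
    proof cases
      case 1
      then have "g \<in> stab" using pow by simp
      then show False using gg H.m_closed stab_sub_D by blast
    next
      case 2
      then have "g \<otimes> g \<in> stab" using pow by (simp add: numeral_2_eq_2)
      then show False using gg stab_sub_D by blast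
    next
      case 3
      then have "g \<otimes> g \<otimes> g \<in> stab" using pow by (simp add: numeral_3_eq_3)
      moreover have "inv g \<otimes> (g \<otimes> g \<otimes> g) = g \<otimes> g" by (simp add: cancel_simps)
      ultimately show False using gg D by (auto simp: l_coset_def)
    qed
  qed
  then have "two_coset_form G A stab x g"
    using A stab_subgroup finite_stab by (simp add: two_coset_form_def)
  then show ?thesis by blast
qed

section \<open>Conflicts in the presence of a mixed overlap\<close>

text \<open>For a mixed \<open>f\<close>, half of \<open>A\<close>, translated by \<open>f\<close>,
  lands in \<open>overlap f \<inter> overlap d\<close>. Both overlaps are halves of
  \<open>A\<close>, so they coincide, a contradiction.\<close>

lemma pure_of_two_conflicts:
  assumes c: "conflict d e" and c': "conflict d' e" and dd': "d \<otimes> inv d' \<notin> stab"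
    and f: "f \<in> D" "f \<notin> stab"
  shows "overlap f = overlap d \<or> overlap f = overlap e"
proof (rule ccontr)
  assume mixed: "\<not> ?thesis"
  have [simp]: "d \<in> carrier G" "e \<in> carrier G" "d' \<in> carrier G" "f \<in> carrier G"
    using c c' f by (auto simp: conflict_def)
  have same: "overlap d' = overlap d"
    using conflict_complement[OF c] conflict_complement[OF c'] by simp
  have comp: "overlap e = A - overlap d" by (rule conflict_complement[OF conflict_sym[OF c]])
  have "\<not> conflict f d" "\<not> conflict f e" "\<not> conflict f d'"
    using mixed comp conflict_complement[OF c] same
    by (metis conflict_complement)+
  then have D: "d \<otimes> inv f \<in> D" "e \<otimes> inv f \<in> D" "d' \<otimes> inv f \<in> D"
    using c c' f by (auto simp: conflict_def diff_D_comm)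
  \<comment> \<open>Dividing by \<open>f\<close> preserves the conflicts with \<open>e\<close>, so
    the quotients of \<open>d\<close> and \<open>d'\<close> by \<open>f\<close> share one overlap
    \<open>Q\<close>.\<close>
  have shift: "(x \<otimes> inv f) \<otimes> inv (e \<otimes> inv f) = x \<otimes> inv e" if "x \<in> carrier G" for x
    using that by (simp add: cancel_simps)
  have cf: "conflict (d \<otimes> inv f) (e \<otimes> inv f)" "conflict (d' \<otimes> inv f) (e \<otimes> inv f)"
    using D c c' shift by (auto simp: conflict_def)
  define Q where "Q = overlap (d \<otimes> inv f)"
  have Q': "Q = overlap (d' \<otimes> inv f)"
    using conflict_complement[OF cf(1)] conflict_complement[OF cf(2)] by (simp add: Q_def)
  have card_Q: "2 * card Q = card A" using conflict_halves(2)[OF cf(1)] by (simp add: Q_def)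
  have "\<not> conflict d' d"
    using conflict_complement[of d' d] same overlap_ne[of d] c overlap_sub
    by (auto simp: conflict_def)
  then have w: "d' \<otimes> inv d \<in> D" using c c' by (auto simp: conflict_def)
  have w': "d' \<otimes> inv d \<notin> stab"
    using dd' inv_stab[of "d' \<otimes> inv d"] by (auto simp: inv_mult_group)
  have inj: "inj_on (\<lambda>a. a \<otimes> x) S" if "S \<subseteq> A" "x \<in> carrier G" for x S
    using that A_sub by (intro inj_onI) (metis r_cancel subsetD)
  \<comment> \<open>The inclusion uses \<open>overlap d' = overlap d\<close>. Equality is by size:
    \<open>d' \<otimes> inv d\<close> lies in \<open>D\<close> but outside \<open>stab\<close>, so
    its overlap is exactly half of \<open>A\<close>; this is where the two cosets must
    differ.\<close>
  have dd_overlap: "(\<lambda>b. b \<otimes> inv d) ` overlap d = overlap (d' \<otimes> inv d)"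
  proof (rule card_subset_eq)
    show "(\<lambda>b. b \<otimes> inv d) ` overlap d \<subseteq> overlap (d' \<otimes> inv d)"
    proof
      fix y assume "y \<in> (\<lambda>b. b \<otimes> inv d) ` overlap d"
      then obtain b where b: "b \<in> overlap d" "y = b \<otimes> inv d" by blast
      then have "b \<in> A" "b \<otimes> inv d \<in> A" "b \<otimes> inv d' \<in> A"
        using same by (auto simp: overlap_def)
      then show "y \<in> overlap (d' \<otimes> inv d)" using b by (simp add: overlap_def cancel_simps)
    qed
    have "card ((\<lambda>b. b \<otimes> inv d) ` overlap d) = card (overlap d)"
      by (rule card_image[OF inj[OF overlap_sub]]) simp
    then show "card ((\<lambda>b. b \<otimes> inv d) ` overlap d) = card (overlap (d' \<otimes> inv d))"
      using conflict_halves(2)[OF c] card_overlap_outside_stab[OF w w'] by simp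
  qed simp
  have Q_sub: "a \<otimes> f \<in> overlap f \<inter> overlap d" if "a \<in> Q" for a
  proof -
    have a: "a \<in> A" "a \<otimes> inv (d \<otimes> inv f) \<in> A" using that by (auto simp: Q_def overlap_def)
    have a': "a \<otimes> inv (d' \<otimes> inv f) \<in> A" using that by (auto simp: Q' overlap_def)
    have "(a \<otimes> f) \<otimes> inv d \<in> A" "(a \<otimes> f) \<otimes> inv d' \<in> A"
      using a a' by (simp_all add: cancel_simps)
    then have "(a \<otimes> f) \<otimes> inv d \<in> overlap (d' \<otimes> inv d)"
      using a by (simp add: overlap_def cancel_simps)
    then obtain b where b: "b \<in> overlap d" "(a \<otimes> f) \<otimes> inv d = b \<otimes> inv d"
      using dd_overlap by blast
    then have "a \<otimes> f = b" using a by simp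
    then show ?thesis using b a overlap_sub by (auto simp: overlap_def cancel_simps)
  qed
  have "card Q = card ((\<lambda>a. a \<otimes> f) ` Q)"
    by (rule card_image[symmetric, OF inj]) (auto simp: Q_def overlap_def)
  then have le: "card Q \<le> card (overlap f \<inter> overlap d)"
    using Q_sub by (simp add: card_mono image_subset_iff)
  have "card (overlap f) = card Q" "card (overlap d) = card Q"
    using card_Q card_overlap_outside_stab[OF f] conflict_halves(2)[OF c] by simp_all
  then have "overlap f \<inter> overlap d = overlap f" "overlap f \<inter> overlap d = overlap d"
    using le by (intro card_seteq; simp)+
  then show False using mixed by simp
qed

text \<open>\<open>U\<close> collects the first entries of the conflicts with difference
  \<open>z\<close>. Uniqueness makes \<open>U\<close> nearly closed under dividing by elements of
  \<open>D\<close>; the mixed \<open>f\<close> leads from \<open>d\<close> to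
  \<open>e \<in> U\<close>, and dividing \<open>e\<close> by \<open>d\<close> leaves only the
  conclusion.\<close>

lemma double_conflict_in_stab:
  assumes c: "conflict d e"
    and unique: "\<And>x x' y. conflict x y \<Longrightarrow> conflict x' y \<Longrightarrow> x \<otimes> inv x' \<in> stab"
    and f: "f \<in> D" "f \<notin> stab" "overlap f \<noteq> overlap d" "overlap f \<noteq> overlap e"
  shows "(d \<otimes> inv e) \<otimes> (d \<otimes> inv e) \<in> stab"
proof -
  define z where "z = d \<otimes> inv e"
  define U where "U = {u \<in> D. u \<otimes> inv z \<in> D}"
  have [simp]: "d \<in> carrier G" "e \<in> carrier G" "f \<in> carrier G" "z \<in> carrier G"
    using c f by (auto simp: conflict_def z_def)
  have dD: "d \<in> D" and eD: "e \<in> D" and zD: "z \<notin> D" using c by (auto simp: conflict_def z_def)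
  have U_conflict: "conflict u (u \<otimes> inv z)" if "u \<in> U" for u
    using that zD by (simp add: U_def conflict_def cancel_simps)
  \<comment> \<open>If \<open>x\<close> is in conflict with neither \<open>u\<close> nor its partner
    \<open>u \<otimes> inv z\<close>, both quotients by \<open>x\<close> lie in \<open>D\<close>.
    Otherwise uniqueness identifies \<open>x\<close> modulo \<open>stab\<close> with one of the
    two.\<close>
  have U_diff: "u \<otimes> inv x \<in> U \<or> u \<otimes> inv x \<in> stab \<or> (u \<otimes> inv x) \<otimes> inv z \<in> stab"
    if u: "u \<in> U" and x: "x \<in> D" for u x
  proof -
    let ?e = "u \<otimes> inv z"
    have cu: "conflict u ?e" by (rule U_conflict[OF u])
    then have [simp]: "u \<in> carrier G" "x \<in> carrier G" using x by (auto simp: conflict_def)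
    consider "conflict u x" | "conflict x ?e"
      | "u \<otimes> inv x \<in> D" "?e \<otimes> inv x \<in> D"
      using cu x conflict_sym unfolding conflict_def by (meson diff_D_comm D_carrier)
    then show ?thesis
    proof cases
      case 1
      then have "?e \<otimes> inv x \<in> stab" using unique cu conflict_sym by blast
      then show ?thesis by (simp add: m_ac)
    next
      case 2
      then show ?thesis using unique cu by blast
    next
      case 3
      then show ?thesis by (simp add: U_def m_ac)
    qed
  qed
  have "d \<otimes> inv z = e" by (simp add: z_def cancel_simps)
  then have dU: "d \<in> U" using dD eD by (simp add: U_def)
  have comp: "overlap d = A - overlap e" "overlap e = A - overlap d"
    using conflict_complement c conflict_sym by blast+
  have "\<not> conflict d f" "\<not> conflict e f"
    using comp f(3,4) conflict_complement conflict_sym by metis+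
  then have df: "d \<otimes> inv f \<in> D" and ef: "e \<otimes> inv f \<in> D"
    using dD eD f by (auto simp: conflict_def)
  \<comment> \<open>A second member of \<open>U\<close>. It is not in conflict with
    \<open>e\<close>, as \<open>d\<close> is and \<open>d \<otimes> inv u = f \<notin> stab\<close>;
    so \<open>u\<close> may be divided by \<open>u \<otimes> inv e\<close> to reach
    \<open>e\<close>.\<close>
  define u where "u = d \<otimes> inv f"
  have [simp]: "u \<in> carrier G" by (simp add: u_def)
  have "u \<otimes> inv z = e \<otimes> inv f" by (simp add: u_def z_def cancel_simps)
  then have uU: "u \<in> U" using df ef by (simp add: U_def u_def)
  have "e \<in> U"
  proof -
    have "\<not> conflict u e"
    proof
      assume "conflict u e"
      then have "d \<otimes> inv u \<in> stab" using unique c by blast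
      then show False using f(2) by (simp add: u_def cancel_simps)
    qed
    then have ue: "u \<otimes> inv e \<in> D" using eD df by (simp add: conflict_def u_def)
    have "u \<otimes> inv (u \<otimes> inv e) = e" by (simp add: cancel_simps)
    then consider "e \<in> U" | "e \<in> stab" | "e \<otimes> inv z \<in> stab" using U_diff[OF uU ue] by auto
    then show ?thesis
    proof cases
      case 2
      then have "inv e \<otimes> d \<in> D" using inv_stab stab_D dD by blast
      then show ?thesis using zD by (simp add: z_def m_comm)
    next
      case 3
      then show ?thesis using stab_sub_D eD by (simp add: U_def)
    qed
  qed
  have z: "e \<otimes> inv d = inv z" by (simp add: z_def inv_mult_group)
  have "inv z \<notin> D" using zD inv_D_iff by simp
  \<comment> \<open>The quotient of \<open>e\<close> by \<open>d\<close> is \<open>inv z\<close>,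
    which is not in \<open>D\<close>, so the first two alternatives of \<open>U_diff\<close>
    fail.\<close>
  then have "inv z \<otimes> inv z \<in> stab"
    using U_diff[OF \<open>e \<in> U\<close> dD] stab_sub_D by (auto simp: z U_def)
  then have "inv (inv z \<otimes> inv z) \<in> stab" by (rule inv_stab)
  then show ?thesis by (simp add: inv_mult z_def[symmetric])
qed

lemma subgroup_or_two_cosets:
  assumes no_invol: "\<And>y. y \<in> carrier G \<Longrightarrow> y \<otimes> y = \<one> \<Longrightarrow> y = \<one>"
  shows "subgroup D G \<or> (\<exists>H x g. two_coset_form G A H x g)"
proof (rule ccontr)
  assume neg: "\<not> ?thesis"
  then obtain d e where c: "conflict d e" using subgroup_D by blast
  \<comment> \<open>Failure of the two-coset form supplies a mixed \<open>f\<close> for every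
    conflict, which rules out conflicts of one element with two cosets and starts the argument with
    \<open>U\<close>.\<close>
  have pure: "\<exists>f\<in>D. f \<notin> stab \<and> overlap f \<noteq> overlap x \<and> overlap f \<noteq> overlap y"
    if "conflict x y" for x y
    using two_coset_form_of_pure[OF that] neg by blast
  have unique: "x \<otimes> inv x' \<in> stab" if "conflict x y" "conflict x' y" for x x' y
    using pure[OF that(1)] pure_of_two_conflicts[OF that] by blast
  obtain f where "f \<in> D" "f \<notin> stab" "overlap f \<noteq> overlap d" "overlap f \<noteq> overlap e"
    using pure[OF c] by blast
  with c unique have square: "(d \<otimes> inv e) \<otimes> (d \<otimes> inv e) \<in> stab"
    by (rule double_conflict_in_stab)
  have "d \<otimes> inv e \<in> carrier G" using c by (simp add: conflict_def)
  with stab_subgroup finite_stab no_invol have "d \<otimes> inv e \<in> stab"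
    using square by (rule square_in_finite_subgroup)
  then show False using c stab_sub_D by (simp add: conflict_def)
qed

end

section \<open>The dichotomy together with the formula for the difference set\<close>

theorem theorem1p2:
  fixes G :: "('a, 'b) monoid_scheme" and A D :: "'a set"
  assumes "comm_group G"
    and "\<forall>y\<in>carrier G. group.ord G y \<noteq> 2"
    and "A \<subseteq> carrier G" and "finite A" and "A \<noteq> {}"
    and "D = diff_set G A"
    and "\<forall>d\<in>D. real (rep_count G A d) \<ge> real (card A) / 2"
  shows "((subgroup D G \<and> finite D) \<or> (\<exists>H x g. two_coset_form G A H x g)) \<and>
    (\<forall>H x g. two_coset_form G A H x g \<longrightarrow>
      D = ((inv\<^bsub>G\<^esub> g) <#\<^bsub>G\<^esub> H) \<union> H \<union> (g <#\<^bsub>G\<^esub> H))"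
proof -
  have "2 * rep_count G A d \<ge> card A" if "d \<in> diff_set G A" for d
  proof -
    have "real (card A) / 2 \<le> real (rep_count G A d)" using assms(6,7) that by blast
    then show ?thesis by linarith
  qed
  then interpret popular_differences G A
    using assms by (simp add: popular_differences_def popular_differences_axioms_def)
  have no_invol: "y = \<one>\<^bsub>G\<^esub>" if y: "y \<in> carrier G" "y \<otimes>\<^bsub>G\<^esub> y = \<one>\<^bsub>G\<^esub>" for y
  proof -
    have "y [^]\<^bsub>G\<^esub> (2::nat) = \<one>\<^bsub>G\<^esub>" using y by (simp add: numeral_2_eq_2)
    then have "ord y dvd 2" using y(1) pow_eq_id by blast
    then have "ord y = 1" using assms(2) y(1) two_is_prime_nat by (auto simp: prime_nat_iff)
    then show ?thesis using ord_eq_1 y(1) by blast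
  qed
  have "subgroup D G \<and> finite D \<or> (\<exists>H x g. two_coset_form G A H x g)"
    using subgroup_or_two_cosets[OF no_invol] finite_D assms(6) by blast
  moreover have "D = (inv\<^bsub>G\<^esub> g <#\<^bsub>G\<^esub> H) \<union> H \<union> (g <#\<^bsub>G\<^esub> H)"
    if "two_coset_form G A H x g" for H x g
    using that diff_set_two_cosets assms(6) by (simp add: two_coset_form_def)
  ultimately show ?thesis by blast
qed

end
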